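(* Let $\hat\chi^2\triangleq\frac1T\sum_{i=1}^T(r_i^2-1)$ (the empirical estimator of the Pearson divergence $\chi^2(\pi_\theta\|\pi_{\text{old}})$), and let $$c_{\max}\triangleq\max_{1\le i\le T}\hat A_i^2\,\|e_{a_i}-\pi_\theta(\cdot\mid h_{L,i})\|_2^2\,\|h_{L,i}\|_2^2 .$$ Then $$\|G^{\text{lm}}\|_F^2\;\le\;c_{\max}\,(1+\hat\chi^2),$$ or equivalently (when $c_{\max}>0$), $\hat\chi^2\ge \|G^{\text{lm}}\|_F^2/c_{\max}-1$.
   Context: Setting. $T\ge1$ is the number of active tokens; $d_{\text{model}},d_{\text{vocab}}$ are positive integers. For each $i\in\{1,\dots,T\}$: $h_{L,i}\in\mathbb{R}^{d_{\text{model}}}$ is the input of the output layer (lm_head) with weight $W_{\text{lm}}\in\mathbb{R}^{d_{\text{vocab}}\times d_{\text{model}}}$ (shared by all $i$); the logits are $z_i=W_{\text{lm}}h_{L,i}$; the current policy is $\pi_\theta(\cdot\mid h_{L,i})=\mathrm{softmax}(z_i)\in\mathbb{R}^{d_{\text{vocab}}}$. The sampled token is $a_i\in\{1,\dots,d_{\text{vocab}}\}$ and $e_{a_i}\in\mathbb{R}^{d_{\text{vocab}}}$ is its one-hot vector; $\pi_{\text{old}}(a_i)>0$ is a fixed number (probability under the behavior policy); $r_i=\pi_\theta(a_i\mid h_{L,i})/\pi_{\text{old}}(a_i)$ is the importance ratio; $\hat A_i\in\mathbb{R}$ is a fixed advantage. Token objective (unclipped region): $\mathcal{L}_i=r_i\hat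 A_i$. The per-token lm_head gradient is $G_i^{\text{lm}}=\nabla_{W_{\text{lm}}}\mathcal{L}_i$ (matrix of entrywise partial derivatives, with $h_{L,i}$ held fixed, as it does not depend on $W_{\text{lm}}$), and the batch-level gradient is $G^{\text{lm}}=\frac1T\sum_{i=1}^T G_i^{\text{lm}}$. $\|\cdot\|_F$ is the Frobenius norm. *)

theory Defs
  imports "HOL-Analysis.Analysis"
begin

definition softmax :: "real ^ 'v \<Rightarrow> real ^ 'v" where
  "softmax z = (\<chi> j. exp (z $ j) / (\<Sum>k\<in>UNIV. exp (z $ k)))"

definition policy :: "real ^ 'd ^ 'v \<Rightarrow> real ^ 'd \<Rightarrow> real ^ 'v" where
  "policy W h = softmax (W *v h)"

text \<open>Here \<open>q > 0\<close> stands for the behavior-policy probability of the sampled token \<open>a\<close>;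
  it is a constant, independent of \<open>W\<close>.\<close>

definition importance_ratio :: "real ^ 'd ^ 'v \<Rightarrow> real ^ 'd \<Rightarrow> 'v \<Rightarrow> real \<Rightarrow> real" where
  "importance_ratio W h a q = policy W h $ a / q"

definition token_objective ::
  "real ^ 'd ^ 'v \<Rightarrow> real ^ 'd \<Rightarrow> 'v \<Rightarrow> real \<Rightarrow> real \<Rightarrow> real" where
  "token_objective W h a q A = importance_ratio W h a q * A"

text \<open>Entry \<open>(j, k)\<close> is the partial derivative of \<open>f\<close> at \<open>W\<close> with respect to \<open>W $ j $ k\<close>:
  \<open>axis j (axis k 1)\<close> is the matrix unit \<open>E\<^sub>j\<^sub>k\<close>. As usual for \<^const>\<open>deriv\<close>, this is
  meaningful only where the partial derivatives exist; see
  \<open>token_objective_differentiable\<close> below.\<close>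

definition matrix_gradient ::
  "(real ^ 'd ^ 'v \<Rightarrow> real) \<Rightarrow> real ^ 'd ^ 'v \<Rightarrow> real ^ 'd ^ 'v" where
  "matrix_gradient f W = (\<chi> j k. deriv (\<lambda>t. f (W + t *\<^sub>R axis j (axis k 1))) 0)"

definition lm_head_grad ::
  "real ^ 'd ^ 'v \<Rightarrow> real ^ 'd \<Rightarrow> 'v \<Rightarrow> real \<Rightarrow> real \<Rightarrow> real ^ 'd ^ 'v" where
  "lm_head_grad W h a q A = matrix_gradient (\<lambda>W'. token_objective W' h a q A) W"

definition batch_lm_head_grad ::
  "nat \<Rightarrow> real ^ 'd ^ 'v \<Rightarrow> (nat \<Rightarrow> real ^ 'd) \<Rightarrow> (nat \<Rightarrow> 'v) \<Rightarrow> (nat \<Rightarrow> real) \<Rightarrow> (nat \<Rightarrow> real)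
    \<Rightarrow> real ^ 'd ^ 'v" where
  "batch_lm_head_grad T W h a q A =
     (1 / real T) *\<^sub>R (\<Sum>i=1..T. lm_head_grad W (h i) (a i) (q i) (A i))"

definition frobenius_norm :: "real ^ 'd ^ 'v \<Rightarrow> real" where
  "frobenius_norm M = sqrt (\<Sum>j\<in>UNIV. \<Sum>k\<in>UNIV. (M $ j $ k)\<^sup>2)"

definition chi2_hat ::
  "nat \<Rightarrow> real ^ 'd ^ 'v \<Rightarrow> (nat \<Rightarrow> real ^ 'd) \<Rightarrow> (nat \<Rightarrow> 'v) \<Rightarrow> (nat \<Rightarrow> real) \<Rightarrow> real" where
  "chi2_hat T W h a q =
     (1 / real T) * (\<Sum>i=1..T. ((importance_ratio W (h i) (a i) (q i))\<^sup>2 - 1))"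

text \<open>\<^const>\<open>norm\<close> on \<^typ>\<open>real ^ 'n\<close> is the Euclidean norm, and \<open>axis a 1\<close> is the one-hot
  vector of \<open>a\<close>.\<close>

definition c_max ::
  "nat \<Rightarrow> real ^ 'd ^ 'v \<Rightarrow> (nat \<Rightarrow> real ^ 'd) \<Rightarrow> (nat \<Rightarrow> 'v) \<Rightarrow> (nat \<Rightarrow> real) \<Rightarrow> real" where
  "c_max T W h a A =
     Max ((\<lambda>i. (A i)\<^sup>2 * (norm (axis (a i) 1 - policy W (h i)))\<^sup>2 * (norm (h i))\<^sup>2) ` {1..T})"

lemma frobenius_norm_eq_norm: "frobenius_norm M = norm M"
  by (simp add: frobenius_norm_def norm_vec_def L2_set_def sum_nonneg)

lemma token_objective_differentiable:
  fixes W :: "real ^ 'd::finite ^ 'v::finite"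
  shows "(\<lambda>W. token_objective W h a q A) differentiable at W"
proof -
  have entry: "bounded_linear (\<lambda>W :: real ^ 'd ^ 'v. W $ j $ k)" for j k
    by (rule bounded_linear_compose[OF bounded_linear_vec_nth bounded_linear_vec_nth])
  have logit: "bounded_linear (\<lambda>W :: real ^ 'd ^ 'v. (W *v h) $ j)" for j
    by (simp add: matrix_vector_mult_def)
      (intro bounded_linear_sum bounded_linear_compose[OF bounded_linear_mult_left entry])
  have e: "(\<lambda>W :: real ^ 'd ^ 'v. exp ((W *v h) $ j)) differentiable at W" for j
    unfolding differentiable_def
    by (rule exI, rule has_derivative_exp, rule bounded_linear_imp_has_derivative, rule logit)
  have "(\<Sum>k\<in>UNIV. exp ((W *v h) $ k)) > 0"
    by (intro sum_pos) auto
  then have pos: "(\<Sum>k\<in>UNIV. exp ((W *v h) $ k)) \<noteq> 0"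
    by linarith
  have "(\<lambda>W :: real ^ 'd ^ 'v. exp ((W *v h) $ a) / (\<Sum>k\<in>UNIV. exp ((W *v h) $ k)) * (A / q))
      differentiable at W"
    by (intro differentiable_mult differentiable_divide differentiable_sum e pos
        differentiable_const ballI finite)
  then show ?thesis
    by (simp add: token_objective_def importance_ratio_def policy_def softmax_def)
qed

end

theory Submission
  imports Defs
begin

text \<open>Each token gradient is the rank-one matrix
  \<open>A r (e\<^sub>a - \<pi>) h\<^sup>T\<close>, so its squared Frobenius norm factorises as
  \<open>r\<^sup>2\<close> times a quantity that the constant bounds. Convexity of the squared norm
  passes to the batch mean, and the mean of the \<open>r\<^sup>2\<close> is one plus the estimator.\<close>

text \<open>Quotient rule along the line: the normaliser \<open>S\<close> has derivative
  \<open>D\<close>, and \<open>D / S\<close> is the mean of \<open>c\<close> under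
  \<open>softmax z\<close>.\<close>

lemma has_field_derivative_softmax_line:
  fixes z c :: "real ^ 'v::finite"
  shows "((\<lambda>t. softmax (z + t *\<^sub>R c) $ a) has_field_derivative
           softmax z $ a * (c $ a - softmax z \<bullet> c)) (at 0)"
proof -
  define S where "S = (\<Sum>k\<in>UNIV. exp (z $ k))"
  have "S > 0"
    unfolding S_def by (intro sum_pos) auto
  have pi: "softmax z $ l = exp (z $ l) / S" for l
    by (simp add: softmax_def S_def)
  have num: "((\<lambda>t. exp (z $ l + t * c $ l)) has_field_derivative exp (z $ l) * c $ l) (at 0)" for l
    by (auto intro!: derivative_eq_intros)
  define D where "D = (\<Sum>l\<in>UNIV. exp (z $ l) * c $ l)"
  have den: "((\<lambda>t. \<Sum>l\<in>UNIV. exp (z $ l + t * c $ l)) has_field_derivative D) (at 0)"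
    unfolding D_def by (intro DERIV_sum num)
  have quot: "((\<lambda>t. exp (z $ a + t * c $ a) / (\<Sum>l\<in>UNIV. exp (z $ l + t * c $ l)))
      has_field_derivative (exp (z $ a) * c $ a * S - exp (z $ a) * D) / (S * S)) (at 0)"
    using DERIV_divide[OF num den] \<open>S > 0\<close> by (simp add: S_def)
  have "softmax z \<bullet> c = D / S"
    by (simp add: pi inner_vec_def D_def sum_divide_distrib)
  then have "softmax z $ a * (c $ a - softmax z \<bullet> c) =
      (exp (z $ a) * c $ a * S - exp (z $ a) * D) / (S * S)"
    using \<open>S > 0\<close> by (simp add: pi field_simps)
  \<comment> \<open>Only the \<open>softmax\<close> at the perturbed point is unfolded;
    \<open>softmax z\<close> in the derivative stays folded.\<close>
  with quot show ?thesis
    by (simp add: softmax_def[of "z + _"])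
qed

text \<open>Perturbing a single entry of the weight moves the logits along one axis, which turns
  partial derivatives in \<open>W\<close> into directional derivatives of
  \<open>softmax\<close>.\<close>

lemma matrix_unit_mult_vec:
  fixes h :: "real ^ 'd::finite"
  shows "(axis j (axis k 1) :: real ^ 'd ^ 'v::finite) *v h = axis j (h $ k)"
proof -
  have "axis j (axis k 1) $ i \<bullet> h = axis j (h $ k) $ i" for i :: 'v
    by (cases "i = j") (simp_all add: axis_def[of j] inner_axis')
  then show ?thesis
    by (simp add: vec_eq_iff matrix_vector_mult_def inner_vec_def)
qed

text \<open>Chain rule: entry \<open>(j, k)\<close> of \<open>W\<close> moves only logit
  \<open>j\<close>, at rate \<open>h $ k\<close>; the factor in \<open>j\<close> is the derivative
  of \<open>softmax\<close> in that logit.\<close>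

lemma lm_head_grad_eq:
  "lm_head_grad W h a q A =
     (\<chi> j k. A * importance_ratio W h a q * (axis a 1 - policy W h) $ j * h $ k)"
proof -
  have "deriv (\<lambda>t. token_objective (W + t *\<^sub>R axis j (axis k 1)) h a q A) 0 =
      A * importance_ratio W h a q * (axis a 1 - policy W h) $ j * h $ k" for j k
  proof (rule DERIV_imp_deriv)
    have line: "token_objective (W + t *\<^sub>R axis j (axis k 1)) h a q A =
        softmax (W *v h + t *\<^sub>R axis j (h $ k)) $ a * (A / q)" for t
      unfolding token_objective_def importance_ratio_def policy_def matrix_vector_mult_add_rdistrib
        scaleR_matrix_vector_assoc[symmetric] matrix_unit_mult_vec
      by simp
    have "((\<lambda>t. softmax (W *v h + t *\<^sub>R axis j (h $ k)) $ a * (A / q)) has_field_derivative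
        softmax (W *v h) $ a * (axis j (h $ k) $ a - softmax (W *v h) \<bullet> axis j (h $ k)) * (A / q))
        (at 0)"
      by (rule DERIV_cmult_right[OF has_field_derivative_softmax_line])
    then show "((\<lambda>t. token_objective (W + t *\<^sub>R axis j (axis k 1)) h a q A) has_field_derivative
        A * importance_ratio W h a q * (axis a 1 - policy W h) $ j * h $ k) (at 0)"
      \<comment> \<open>The match rests on \<open>axis j (h $ k) $ a\<close> being
        \<open>axis a 1 $ j * h $ k\<close>: both vanish unless \<open>j = a\<close>.\<close>
      unfolding line
      by (rule DERIV_cong)
        (simp add: importance_ratio_def policy_def inner_axis, simp add: axis_def algebra_simps)
  qed
  then show ?thesis
    unfolding lm_head_grad_def matrix_gradient_def by (simp only:)
qed

text \<open>The squared entries split into a factor in \<open>j\<close> and a factor in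
  \<open>k\<close>, so the double sum is a product of two sums.\<close>

lemma norm_outer_product_squared:
  fixes u :: "real ^ 'v::finite" and h :: "real ^ 'd::finite"
  shows "(norm (\<chi> j k. s * u $ j * h $ k))\<^sup>2 = s\<^sup>2 * (norm u)\<^sup>2 * (norm h)\<^sup>2"
proof -
  have "(norm (\<chi> j k. s * u $ j * h $ k))\<^sup>2 = (\<Sum>j\<in>UNIV. \<Sum>k\<in>UNIV. s\<^sup>2 * ((u $ j)\<^sup>2 * (h $ k)\<^sup>2))"
    unfolding power2_norm_eq_inner inner_vec_def by (simp add: power2_eq_square mult_ac)
  also have "\<dots> = s\<^sup>2 * ((\<Sum>j\<in>UNIV. (u $ j)\<^sup>2) * (\<Sum>k\<in>UNIV. (h $ k)\<^sup>2))"
    by (subst sum_product) (simp only: sum_distrib_left)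
  also have "\<dots> = s\<^sup>2 * (norm u)\<^sup>2 * (norm h)\<^sup>2"
    unfolding power2_norm_eq_inner inner_vec_def by (simp add: power2_eq_square)
  finally show ?thesis .
qed

text \<open>Triangle inequality, then Cauchy-Schwarz against the constant 1, which costs a factor
  \<open>card I\<close>.\<close>

lemma norm_mean_squared_le:
  fixes f :: "'i \<Rightarrow> 'a::real_normed_vector"
  shows "(norm ((1 / real (card I)) *\<^sub>R sum f I))\<^sup>2
           \<le> (1 / real (card I)) * (\<Sum>i\<in>I. (norm (f i))\<^sup>2)"
proof (cases "card I = 0")
  case False
  have "(norm (sum f I))\<^sup>2 \<le> (\<Sum>i\<in>I. norm (f i))\<^sup>2"
    by (intro power_mono norm_sum norm_ge_zero)
  also have "\<dots> \<le> (\<Sum>i\<in>I. (norm (f i))\<^sup>2) * card I"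
    by (rule sum_squared_le_sum_of_squares)
  finally show ?thesis
    using False by (simp add: power2_eq_square field_simps)
\<comment> \<open>Here \<open>1 / real (card I)\<close> is \<open>1 / 0 = 0\<close>, so both sides
  are 0.\<close>
qed simp

theorem theorem2:
  fixes T :: nat
    and W :: "real ^ 'd::finite ^ 'v::finite"
    and h :: "nat \<Rightarrow> real ^ 'd"
    and a :: "nat \<Rightarrow> 'v"
    and pi_old :: "nat \<Rightarrow> real"
    and A :: "nat \<Rightarrow> real"
  assumes "T \<ge> 1"
    and "\<And>i. i \<in> {1..T} \<Longrightarrow> pi_old i > 0"
  shows "(frobenius_norm (batch_lm_head_grad T W h a pi_old A))\<^sup>2
           \<le> c_max T W h a A * (1 + chi2_hat T W h a pi_old)
       \<and> (c_max T W h a A > 0 \<longrightarrow>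
           chi2_hat T W h a pi_old
             \<ge> (frobenius_norm (batch_lm_head_grad T W h a pi_old A))\<^sup>2 / c_max T W h a A - 1)"
proof -
  let ?r = "\<lambda>i. importance_ratio W (h i) (a i) (pi_old i)"
  let ?G = "\<lambda>i. lm_head_grad W (h i) (a i) (pi_old i) (A i)"
  let ?c = "c_max T W h a A"
  have token: "(norm (?G i))\<^sup>2 \<le> ?c * (?r i)\<^sup>2" if "i \<in> {1..T}" for i
  proof -
    let ?m = "(A i)\<^sup>2 * (norm (axis (a i) 1 - policy W (h i)))\<^sup>2 * (norm (h i))\<^sup>2"
    have "?m \<le> ?c"
      unfolding c_max_def using that by (intro Max_ge) auto
    then have "?m * (?r i)\<^sup>2 \<le> ?c * (?r i)\<^sup>2"
      by (rule mult_right_mono) simp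
    then show ?thesis
      \<comment> \<open>With \<open>s = A i * ?r i\<close> the factorised squared norm is exactly
        \<open>?m * (?r i)\<^sup>2\<close>.\<close>
      unfolding lm_head_grad_eq norm_outer_product_squared by (simp add: power_mult_distrib mult_ac)
  qed
  have "(frobenius_norm (batch_lm_head_grad T W h a pi_old A))\<^sup>2
      \<le> (1 / real T) * (\<Sum>i=1..T. (norm (?G i))\<^sup>2)"
    using norm_mean_squared_le[of "{1..T}" ?G]
    by (simp add: frobenius_norm_eq_norm batch_lm_head_grad_def)
  also have "\<dots> \<le> (1 / real T) * (\<Sum>i=1..T. ?c * (?r i)\<^sup>2)"
    by (intro mult_left_mono sum_mono token) auto
  \<comment> \<open>The terms \<open>- 1\<close> in \<open>chi2_hat\<close> average to -1 because
    \<open>T\<close> is nonzero, leaving the mean of the squared ratios.\<close>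
  also have "\<dots> = ?c * (1 + chi2_hat T W h a pi_old)"
    using \<open>T \<ge> 1\<close> by (simp add: chi2_hat_def sum_subtractf sum_distrib_left[symmetric] field_simps)
  finally have "(frobenius_norm (batch_lm_head_grad T W h a pi_old A))\<^sup>2
      \<le> ?c * (1 + chi2_hat T W h a pi_old)" .
  then show ?thesis
    by (simp add: field_simps)
qed

end
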